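(* There exists a sequence $\{Q_n\}_{n\in\mathbb{N}}$ of quadrature formulas on $\mathbb{S}^2$, $Q_n(f)=\sum_{j=1}^{N_n}w_j^{(n)}f(\mathbf{x}_j^{(n)})$, satisfying the uniform P\'olya stability condition (there is $M>0$ independent of $n$ with $\sup_{n\in\mathbb{N}}\sum_{j=1}^{N_n}|w_j^{(n)}|\leq M$), whereas there exists no constant $C>0$ independent of $n$ such that for every $n\in\mathbb{N}$ $$\sum_{j=1}^{N_n}|w_j^{(n)}||p(\mathbf{x}_j^{(n)})|\leq C\|p\|_{L^2(\mathbb{S}^2)}\quad\text{for all } p\in\mathbb{P}_n(\mathbb{S}^2).$$
   Context: $\mathbb{S}^2=\{\mathbf{x}\in\mathbb{R}^3:\|\mathbf{x}\|_2=1\}$ carries the surface measure $\omega$ with $\omega(\mathbb{S}^2)=4\pi$; $L^2(\mathbb{S}^2)$ is taken with respect to $\omega$. $\mathbb{N}=\{1,2,\ldots\}$. $\mathbb{P}_n(\mathbb{S}^2)$ is the space of spherical polynomials of degree at most $n$, i.e. the direct sum of the spaces of real spherical harmonics of degrees $0,\ldots,n$. A quadrature formula is a linear functional $Q(f)=\sum_{j=1}^N w_jf(\mathbf{x}_j)$ on the space $C(\mathbb{S}^2)$ of real continuous functions, given by $N$ pairwise distinct nodes $\mathbf{x}_1,\ldots,\mathbf{x}_N\in\mathbb{S}^2$ and arbitrary real weights. In a sequence $\{Q_n\}$, the nodes, weights and number of nodes $N_n$ may all depend on $n$. *)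

theory Defs
  imports "HOL-Analysis.Analysis"
begin

abbreviation S2 :: "(real ^ 3) set" where
  "S2 \<equiv> sphere 0 1"

subsection \<open>Surface measure and L2 norm\<close>

definition spherical_coords :: "real \<times> real \<Rightarrow> real ^ 3" where
  "spherical_coords = (\<lambda>(\<theta>, \<phi>). vector [sin \<theta> * cos \<phi>, sin \<theta> * sin \<phi>, cos \<theta>])"

text \<open>
  The parametrization is injective on the open rectangle and its image misses only a
  half circle; its area element, the norm of the cross product of the two partial
  derivatives, is \<open>sin \<theta>\<close>.
\<close>

definition surface_measure :: "(real ^ 3) measure" where
  "surface_measure =
     distr (density (restrict_space lborel ({0..pi} \<times> {0..2 * pi}))
                    (\<lambda>(\<theta>, \<phi>). ennreal (sin \<theta>)))
           (restrict_space borel S2) spherical_coords"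

definition L2_norm_S2 :: "(real ^ 3 \<Rightarrow> real) \<Rightarrow> real" where
  "L2_norm_S2 f = sqrt (\<integral>x. (f x)\<^sup>2 \<partial>surface_measure)"

subsection \<open>Spherical harmonics and spherical polynomials\<close>

definition laplacian :: "(real ^ 3 \<Rightarrow> real) \<Rightarrow> real ^ 3 \<Rightarrow> real" where
  "laplacian h x = (\<Sum>i\<in>UNIV. (deriv ^^ 2) (\<lambda>t. h (x + t *\<^sub>R axis i 1)) 0)"

definition solid_harmonic :: "nat \<Rightarrow> (real ^ 3 \<Rightarrow> real) \<Rightarrow> bool" where
  "solid_harmonic l h \<longleftrightarrow>
     real_polynomial_function h \<and>
     (\<forall>t x. h (t *\<^sub>R x) = t ^ l * h x) \<and>
     (\<forall>x. laplacian h x = 0)"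

text \<open>
  Functions on the sphere are represented by functions on the ambient space whose values
  off the sphere are irrelevant: membership in the two spaces below, the norm above, and
  quadrature sums depend only on the values on \<^const>\<open>S2\<close>.
\<close>

definition spherical_harmonics :: "nat \<Rightarrow> (real ^ 3 \<Rightarrow> real) set" where
  "spherical_harmonics l = {Y. \<exists>h. solid_harmonic l h \<and> (\<forall>x\<in>S2. Y x = h x)}"

definition spherical_polynomials :: "nat \<Rightarrow> (real ^ 3 \<Rightarrow> real) set" where
  "spherical_polynomials n =
     {p. \<exists>Y. (\<forall>l\<le>n. Y l \<in> spherical_harmonics l) \<and> (\<forall>x\<in>S2. p x = (\<Sum>l\<le>n. Y l x))}"

subsection \<open>Quadrature formulas\<close>

text \<open>Only the values of the functional \<open>Q\<close> on continuous functions on the sphere matter.\<close>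

definition quadrature_formula ::
  "((real ^ 3 \<Rightarrow> real) \<Rightarrow> real) \<Rightarrow> nat \<Rightarrow> (nat \<Rightarrow> real) \<Rightarrow> (nat \<Rightarrow> real ^ 3) \<Rightarrow> bool" where
  "quadrature_formula Q N w x \<longleftrightarrow>
     N \<ge> 1 \<and> x ` {1..N} \<subseteq> S2 \<and> inj_on x {1..N} \<and>
     (\<forall>f. continuous_on S2 f \<longrightarrow> Q f = (\<Sum>j=1..N. w j * f (x j)))"

text \<open>The first argument gives the number of nodes, the second the weights.\<close>

definition uniformly_Polya_stable :: "(nat \<Rightarrow> nat) \<Rightarrow> (nat \<Rightarrow> nat \<Rightarrow> real) \<Rightarrow> bool" where
  "uniformly_Polya_stable N w \<longleftrightarrow> (\<exists>M>0. \<forall>n\<ge>1. (\<Sum>j=1..N n. \<bar>w n j\<bar>) \<le> M)"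

subsection \<open>Normalization of the surface measure\<close>

lemma continuous_on_spherical_coords: "continuous_on A spherical_coords"
proof -
  have eq: "spherical_coords = (\<lambda>z. \<chi> i. if i = 1 then sin (fst z) * cos (snd z)
          else if i = 2 then sin (fst z) * sin (snd z) else cos (fst z))"
    by (auto simp: spherical_coords_def vec_eq_iff forall_3 vector_3 fun_eq_iff)
  have "continuous_on A (\<lambda>z. if i = 1 then sin (fst z) * cos (snd z)
          else if i = 2 then sin (fst z) * sin (snd z) else cos (fst z))" for i :: 3
    by (cases "i = 1"; cases "i = 2"; simp; intro continuous_intros)
  then show ?thesis
    unfolding eq by (rule continuous_on_vec_lambda)
qed

lemma spherical_coords_in_S2: "spherical_coords z \<in> S2"
proof -
  obtain a b where z: "z = (a, b)" by (cases z)
  have "(sin a * cos b)\<^sup>2 + (sin a * sin b)\<^sup>2 + (cos a)\<^sup>2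
      = (sin a)\<^sup>2 * ((sin b)\<^sup>2 + (cos b)\<^sup>2) + (cos a)\<^sup>2"
    by (simp only: power_mult_distrib distrib_left)
  also have "\<dots> = 1" by (simp only: sin_cos_squared_add mult_1_right)
  finally show ?thesis
    by (simp add: z spherical_coords_def norm_vec_def L2_set_def sum_3 vector_3)
qed

lemma measurable_spherical_coords:
  "spherical_coords \<in> restrict_space lborel B \<rightarrow>\<^sub>M restrict_space borel S2"
proof (rule measurable_restrict_space1, rule measurable_restrict_space2)
  have "spherical_coords \<in> borel_measurable borel"
    by (intro borel_measurable_continuous_onI continuous_on_spherical_coords)
  then show "spherical_coords \<in> borel_measurable lborel" by simp
qed (use spherical_coords_in_S2 in auto)

lemma emeasure_surface_measure_S2: "emeasure surface_measure S2 = ennreal (4 * pi)"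
proof -
  let ?R = "{0..pi} \<times> {0..2 * pi}"
  let ?M = "restrict_space lborel ?R"
  let ?g = "\<lambda>(\<theta>, \<phi>). ennreal (sin \<theta>)"
  have R: "?R \<in> sets lborel" by (simp add: closed_Times borel_closed)
  have g: "?g \<in> borel_measurable lborel"
    unfolding case_prod_beta measurable_lborel2
    by (rule measurable_compose[OF _ measurable_ennreal])
      (intro borel_measurable_continuous_onI continuous_intros)
  have sp: "space ?M = ?R" by (simp add: space_restrict_space)
  have "emeasure surface_measure S2 = emeasure (density ?M ?g) ?R"
    unfolding surface_measure_def
    using spherical_coords_in_S2 measurable_spherical_coords
    by (subst emeasure_distr) (auto simp: sp sets_restrict_space intro!: arg_cong2[where f=emeasure])
  also have "\<dots> = (\<integral>\<^sup>+z. ?g z * indicator ?R z \<partial>?M)"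
    using R g by (subst emeasure_density) 
      (auto intro: measurable_restrict_space1 simp: sets_restrict_space)
  also have "\<dots> = (\<integral>\<^sup>+z. ?g z * indicator ?R z \<partial>lborel)"
    using R by (subst nn_integral_restrict_space) (auto simp: mult.assoc indicator_def intro!: nn_integral_cong)
  also have "\<dots> = (\<integral>\<^sup>+z. (ennreal (sin (fst z)) * indicator {0..pi} (fst z)) * indicator {0..2*pi} (snd z) \<partial>(lborel \<Otimes>\<^sub>M lborel))"
    unfolding lborel_prod by (intro nn_integral_cong) (auto simp: indicator_def split: prod.splits)
  also have "\<dots> = (\<integral>\<^sup>+a. (\<integral>\<^sup>+b. (ennreal (sin a) * indicator {0..pi} a) * indicator {0..2*pi} b \<partial>lborel) \<partial>lborel)"
    by (subst lborel.nn_integral_fst[symmetric]) simp_all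
  also have "\<dots> = (\<integral>\<^sup>+a. ennreal (sin a) * indicator {0..pi} a \<partial>lborel) * ennreal (2 * pi)"
    by (simp add: nn_integral_cmult nn_integral_multc)
  also have "(\<integral>\<^sup>+a. ennreal (sin a) * indicator {0..pi} a \<partial>lborel) = ennreal (- cos pi - (- cos 0))"
    by (rule nn_integral_FTC_Icc) (auto intro!: derivative_eq_intros sin_ge_zero)
  also have "\<dots> * ennreal (2 * pi) = ennreal (4 * pi)"
    by (simp add: ennreal_mult[symmetric] flip: ennreal_numeral)
  finally show ?thesis .
qed

end

theory Submission
  imports Defs
begin

text \<open>
  Point evaluation at \<open>(1, 0, 0)\<close> already violates the inequality. The sectoral harmonics
  \<open>Re ((x\<^sub>1 + \<i> x\<^sub>2)\<^sup>n)\<close> take the value \<open>1\<close> there, are bounded by \<open>1\<close> on the sphere, and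
  tend to \<open>0\<close> off the equator, which is a null set; hence their \<open>L\<^sup>2\<close> norms tend to \<open>0\<close> by
  dominated convergence.
\<close>

definition sectoral_harmonic :: "nat \<Rightarrow> real ^ 3 \<Rightarrow> real" where
  "sectoral_harmonic n x = Re (Complex (x $ 1) (x $ 2) ^ n)"

lemma real_polynomial_function_vec_nth: "real_polynomial_function (\<lambda>x :: real ^ 'n. x $ i)"
  by (rule real_polynomial_function.intros(1)) (rule bounded_linear_vec_nth)

lemma real_polynomial_function_sectoral_harmonic: "real_polynomial_function (sectoral_harmonic n)"
proof -
  \<comment> \<open>The imaginary part joins the induction because the real part of a product of
    complex numbers involves both imaginary parts.\<close>
  have "real_polynomial_function (\<lambda>x :: real ^ 3. Re (Complex (x $ 1) (x $ 2) ^ n)) \<and>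
        real_polynomial_function (\<lambda>x :: real ^ 3. Im (Complex (x $ 1) (x $ 2) ^ n))"
  proof (induction n)
    case 0
    then show ?case by (simp add: real_polynomial_function.intros(2))
  next
    case (Suc n)
    then show ?case
      by (auto intro!: real_polynomial_function_diff real_polynomial_function.intros(3,4)
          real_polynomial_function_vec_nth)
  qed
  then show ?thesis
    by (simp add: sectoral_harmonic_def[abs_def])
qed

text \<open>The factor \<open>d\<close> makes the right-hand side an instance of the left-hand
  pattern, so that rewriting twice gives the second derivative. For \<open>n = 0\<close> the
  truncated exponent is harmless, since the factor \<open>of_nat n\<close> vanishes.\<close>

lemma deriv_Re_affine_power:
  "deriv (\<lambda>t. Re (d * (z + of_real t * c) ^ n)) =
     (\<lambda>t. Re (d * of_nat n * c * (z + of_real t * c) ^ (n - 1)))"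
proof
  fix t :: real
  have "((\<lambda>u. d * (z + u * c) ^ n) has_field_derivative
      d * of_nat n * c * (z + of_real t * c) ^ (n - 1)) (at (of_real t))"
    by (rule derivative_eq_intros refl | simp)+
  \<comment> \<open>The complex derivative is restricted to the real line before its real part is
    taken.\<close>
  from has_field_derivative_Re[OF has_vector_derivative_real_field[OF this]]
  show "deriv (\<lambda>t. Re (d * (z + of_real t * c) ^ n)) t =
      Re (d * of_nat n * c * (z + of_real t * c) ^ (n - 1))"
    by (rule DERIV_imp_deriv)
qed

text \<open>In the direction of the i-th axis, \<open>z\<close> moves with velocity
  \<open>c i\<close>, so the second derivative is the real part of n (n - 1) (c i)^2 z^(n - 2). The
  three squares are 1, -1 and 0 and cancel.\<close>

lemma laplacian_sectoral_harmonic: "laplacian (sectoral_harmonic n) x = 0"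
proof -
  define z where "z = Complex (x $ 1) (x $ 2)"
  define c where "c i = Complex (axis i 1 $ 1) (axis i 1 $ 2)" for i :: 3
  \<comment> \<open>The factor \<open>1\<close> is kept so that \<open>deriv_Re_affine_power\<close>
    matches with \<open>d = 1\<close>.\<close>
  have line: "(\<lambda>t. sectoral_harmonic n (x + t *\<^sub>R axis i 1)) =
      (\<lambda>t. Re (1 * (z + of_real t * c i) ^ n))" for i
  proof
    fix t
    have "Complex ((x + t *\<^sub>R axis i 1) $ 1) ((x + t *\<^sub>R axis i 1) $ 2) = z + of_real t * c i"
      by (simp add: z_def c_def complex_eq_iff)
    then show "sectoral_harmonic n (x + t *\<^sub>R axis i 1) = Re (1 * (z + of_real t * c i) ^ n)"
      by (simp add: sectoral_harmonic_def)
  qed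
  have "(deriv ^^ 2) (\<lambda>t. sectoral_harmonic n (x + t *\<^sub>R axis i 1)) 0 =
      Re (of_nat n * c i * of_nat (n - 1) * c i * z ^ (n - 1 - 1))" for i
    unfolding line numeral_2_eq_2 funpow.simps o_apply id_apply deriv_Re_affine_power by simp
  then have "laplacian (sectoral_harmonic n) x =
      (\<Sum>i\<in>UNIV. Re (of_nat n * c i * of_nat (n - 1) * c i * z ^ (n - 1 - 1)))"
    unfolding laplacian_def by simp
  moreover have "c 1 = 1" "c 2 = \<i>" "c 3 = 0"
    by (simp_all add: c_def axis_def complex_eq_iff)
  ultimately show ?thesis
    by (simp add: sum_3)
qed

lemma solid_harmonic_sectoral_harmonic: "solid_harmonic n (sectoral_harmonic n)"
proof -
  have "Complex (t * a) (t * b) = of_real t * Complex a b" for t a b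
    by (simp add: complex_eq_iff)
  then have "sectoral_harmonic n (t *\<^sub>R x) = t ^ n * sectoral_harmonic n x" for t x
    by (simp add: sectoral_harmonic_def power_mult_distrib flip: of_real_power)
  then show ?thesis
    by (simp add: solid_harmonic_def real_polynomial_function_sectoral_harmonic
        laplacian_sectoral_harmonic)
qed

text \<open>Supplies the components of degree other than \<open>n\<close> when a harmonic of degree
  \<open>n\<close> is viewed as a spherical polynomial.\<close>

lemma zero_in_spherical_harmonics: "(\<lambda>x. 0) \<in> spherical_harmonics l"
proof -
  have "(deriv ^^ 2) (\<lambda>t :: real. 0 :: real) = (\<lambda>t. 0)"
    by (simp add: numeral_2_eq_2)
  then have "solid_harmonic l (\<lambda>x. 0)"
    by (simp add: solid_harmonic_def laplacian_def real_polynomial_function.intros(2))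
  then show ?thesis
    by (auto simp: spherical_harmonics_def)
qed

lemma spherical_harmonics_subset_spherical_polynomials:
  "spherical_harmonics n \<subseteq> spherical_polynomials n"
proof
  fix Y assume "Y \<in> spherical_harmonics n"
  then have "\<forall>l\<le>n. (if l = n then Y else (\<lambda>x. 0)) \<in> spherical_harmonics l"
    by (simp add: zero_in_spherical_harmonics)
  moreover have "Y x = (\<Sum>l\<le>n. (if l = n then Y else (\<lambda>x. 0)) x)" for x
    by (simp add: if_distribR)
  ultimately show "Y \<in> spherical_polynomials n"
    unfolding spherical_polynomials_def
    by (intro CollectI exI[where x = "\<lambda>l. if l = n then Y else (\<lambda>x. 0)"]) simp
qed

lemma sectoral_harmonic_in_spherical_polynomials:
  "sectoral_harmonic n \<in> spherical_polynomials n"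
  using solid_harmonic_sectoral_harmonic spherical_harmonics_subset_spherical_polynomials
  by (auto simp: spherical_harmonics_def)

lemma abs_sectoral_harmonic_le: "\<bar>sectoral_harmonic n x\<bar> \<le> cmod (Complex (x $ 1) (x $ 2)) ^ n"
  unfolding sectoral_harmonic_def by (metis abs_Re_le_cmod norm_power)

text \<open>With \<open>abs_sectoral_harmonic_le\<close>, this yields the bound 1 on the whole
  sphere and geometric decay in \<open>n\<close> wherever the third coordinate is nonzero.\<close>

lemma cmod_Complex_S2:
  assumes "x \<in> S2"
  shows "cmod (Complex (x $ 1) (x $ 2)) = sqrt (1 - (x $ 3)\<^sup>2)"
proof -
  have "(x $ 1)\<^sup>2 + (x $ 2)\<^sup>2 + (x $ 3)\<^sup>2 = 1"
    using assms by (simp add: norm_vec_def L2_set_def sum_3)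
  then have "(x $ 1)\<^sup>2 + (x $ 2)\<^sup>2 = 1 - (x $ 3)\<^sup>2"
    by simp
  then show ?thesis
    by (simp add: cmod_def)
qed

text \<open>In the parameter rectangle the equator is the segment \<theta> = \<pi>/2, which is
  Lebesgue null; passing to a density and to an image measure keeps it null.\<close>

lemma AE_surface_measure_off_equator: "AE x in surface_measure. x $ 3 \<noteq> 0"
proof -
  let ?R = "{0..pi} \<times> {0..2 * pi}"
  have "{z :: real \<times> real. z \<bullet> (1, 0) = pi / 2} \<in> null_sets lebesgue"
    using negligible_standard_hyperplane[of "(1, 0) :: real \<times> real" "pi / 2"]
    by (simp add: negligible_iff_null_sets Basis_prod_def)
  \<comment> \<open>Negligibility concerns the completed measure; closedness makes the line a Borel
    set, hence null for \<open>lborel\<close> as well.\<close>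
  moreover have "closed {z :: real \<times> real. z \<bullet> (1, 0) = pi / 2}"
    by (intro closed_Collect_eq continuous_intros)
  ultimately have "{z :: real \<times> real. z \<bullet> (1, 0) = pi / 2} \<in> null_sets lborel"
    by (simp add: null_sets_completion_iff borel_closed)
  then have "AE z in lborel. z \<notin> {z :: real \<times> real. z \<bullet> (1, 0) = pi / 2}"
    by (rule AE_not_in)
  then have "AE z in lborel. z \<in> ?R \<longrightarrow> cos (fst z) \<noteq> 0"
  proof eventually_elim
    case (elim z)
    then show ?case
      \<comment> \<open>Cosine is injective on [0, \<pi>], so \<pi>/2 is its only zero
        there.\<close>
      using cos_inj_pi[of "fst z" "pi / 2"] by (cases z) auto
  qed
  moreover have "?R \<inter> space lborel \<in> sets lborel"
    by (simp add: closed_Times borel_closed)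
  ultimately have "AE z in restrict_space lborel ?R. cos (fst z) \<noteq> 0"
    by (simp add: AE_restrict_space_iff)
  then have *: "AE z in restrict_space lborel ?R. spherical_coords z $ 3 \<noteq> 0"
    by eventually_elim (simp add: spherical_coords_def case_prod_beta)
  have g: "(\<lambda>(\<theta>, \<phi>). ennreal (sin \<theta>)) \<in> borel_measurable (restrict_space lborel ?R)"
    unfolding case_prod_beta
    by (intro measurable_restrict_space1 measurable_compose[OF _ measurable_ennreal])
      (simp, intro borel_measurable_continuous_onI continuous_intros)
  have "(\<lambda>x :: real ^ 3. x $ 3) \<in> borel_measurable (restrict_space borel S2)"
    by (intro measurable_restrict_space1 borel_measurable_continuous_onI continuous_intros)
  then have "{x \<in> space (restrict_space borel S2). x $ 3 \<noteq> (0 :: real)} \<in> sets (restrict_space borel S2)"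
    by measurable
  then show ?thesis
    unfolding surface_measure_def using measurable_spherical_coords *
    by (subst AE_distr_iff) (auto simp: AE_density[OF g] elim: eventually_mono)
qed

lemma L2_norm_sectoral_harmonic_tendsto_0:
  "(\<lambda>n. L2_norm_S2 (sectoral_harmonic n)) \<longlonglongrightarrow> 0"
proof -
  let ?r = "\<lambda>x :: real ^ 3. cmod (Complex (x $ 1) (x $ 2))"
  have space: "space surface_measure = S2" and
    sets: "sets surface_measure = sets (restrict_space borel S2)"
    by (simp_all add: surface_measure_def space_restrict_space)
  have r_le: "?r x \<le> 1" if "x \<in> S2" for x
    by (simp add: cmod_Complex_S2[OF that])
  interpret finite_measure surface_measure
    by standard (simp add: space emeasure_surface_measure_S2)
  have "(\<lambda>n. \<integral>x. (sectoral_harmonic n x)\<^sup>2 \<partial>surface_measure) \<longlonglongrightarrow>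
      (\<integral>x. 0 \<partial>surface_measure)"
  \<comment> \<open>The constant 1 is an integrable majorant because the surface measure is
    finite.\<close>
  proof (rule integral_dominated_convergence[where w = "\<lambda>x. 1"])
    fix n
    have "continuous_on UNIV (sectoral_harmonic n)"
      using real_polynomial_function_sectoral_harmonic continuous_on_polymonial_function
      by (metis real_polynomial_function_eq)
    then have "sectoral_harmonic n \<in> borel_measurable borel"
      by (rule borel_measurable_continuous_onI)
    then have "sectoral_harmonic n \<in> borel_measurable surface_measure"
      by (simp add: measurable_restrict_space1 measurable_cong_sets[OF sets refl])
    then show "(\<lambda>x. (sectoral_harmonic n x)\<^sup>2) \<in> borel_measurable surface_measure"
      by measurable
    show "AE x in surface_measure. norm ((sectoral_harmonic n x)\<^sup>2) \<le> 1"
    proof (rule AE_I2)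
      fix x assume "x \<in> space surface_measure"
      then have "\<bar>sectoral_harmonic n x\<bar> \<le> 1"
        using abs_sectoral_harmonic_le[of n x] power_le_one[of "?r x" n] r_le[of x]
        by (simp add: space)
      then show "norm ((sectoral_harmonic n x)\<^sup>2) \<le> 1"
        by (simp add: abs_square_le_1)
    qed
  next
    show "AE x in surface_measure. (\<lambda>n. (sectoral_harmonic n x)\<^sup>2) \<longlonglongrightarrow> 0"
      \<comment> \<open>\<open>AE_space\<close> provides \<open>x \<in> S2\<close>, on which the
        formula for the modulus depends.\<close>
      using AE_surface_measure_off_equator AE_space
    proof eventually_elim
      case (elim x)
      then have "?r x < 1"
        by (simp add: space cmod_Complex_S2)
      then have "(\<lambda>n. ?r x ^ n) \<longlonglongrightarrow> 0"
        by (intro LIMSEQ_power_zero) simp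
      then have "(\<lambda>n. sectoral_harmonic n x) \<longlonglongrightarrow> 0"
        by (rule Lim_null_comparison[rotated]) (simp add: abs_sectoral_harmonic_le)
      from tendsto_power[OF this, of 2] show ?case by simp
    qed
  qed auto
  from tendsto_real_sqrt[OF this] show ?thesis
    by (simp add: L2_norm_S2_def)
qed

theorem proposition4p6:
  "\<exists>(Q :: nat \<Rightarrow> (real ^ 3 \<Rightarrow> real) \<Rightarrow> real) (N :: nat \<Rightarrow> nat)
     (w :: nat \<Rightarrow> nat \<Rightarrow> real) (x :: nat \<Rightarrow> nat \<Rightarrow> real ^ 3).
     (\<forall>n\<ge>1. quadrature_formula (Q n) (N n) (w n) (x n)) \<and>
     uniformly_Polya_stable N w \<and>
     \<not> (\<exists>C>0. \<forall>n\<ge>1. \<forall>p\<in>spherical_polynomials n.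
           (\<Sum>j=1..N n. \<bar>w n j\<bar> * \<bar>p (x n j)\<bar>) \<le> C * L2_norm_S2 p)"
proof -
  \<comment> \<open>A point of the equator with x1 + i x2 = 1, so every power is 1 there.\<close>
  define e :: "real ^ 3" where "e = axis 1 1"
  have e: "e \<in> S2" and value_e: "sectoral_harmonic n e = 1" for n
  proof -
    have "Complex (e $ 1) (e $ 2) = 1"
      by (simp add: e_def axis_def complex_eq_iff)
    then show "sectoral_harmonic n e = 1"
      by (simp add: sectoral_harmonic_def)
  qed (simp add: e_def)
  have "\<not> (\<exists>C>0. \<forall>n\<ge>1. \<forall>p\<in>spherical_polynomials n. \<bar>p e\<bar> \<le> C * L2_norm_S2 p)"
  proof
    assume "\<exists>C>0. \<forall>n\<ge>1. \<forall>p\<in>spherical_polynomials n. \<bar>p e\<bar> \<le> C * L2_norm_S2 p"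
    then obtain C where
      C: "\<And>n p. n \<ge> 1 \<Longrightarrow> p \<in> spherical_polynomials n \<Longrightarrow> \<bar>p e\<bar> \<le> C * L2_norm_S2 p"
      by blast
    \<comment> \<open>The n-th inequality is tested on the harmonic of degree exactly
      \<open>n\<close>: its left side stays 1 while its right side tends to 0.\<close>
    have "(\<lambda>n. C * L2_norm_S2 (sectoral_harmonic n)) \<longlonglongrightarrow> C * 0"
      by (intro tendsto_intros L2_norm_sectoral_harmonic_tendsto_0)
    moreover have "\<forall>n\<ge>1. 1 \<le> C * L2_norm_S2 (sectoral_harmonic n)"
      using C[OF _ sectoral_harmonic_in_spherical_polynomials] by (simp add: value_e)
    ultimately have "1 \<le> C * 0"
      by (intro LIMSEQ_le_const) blast+
    then show False by simp
  qed
  with e show ?thesis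
    \<comment> \<open>Every formula has the single node \<open>e\<close> with weight 1, so the
      stability bound is \<open>M = 1\<close>.\<close>
    by (intro exI[where x = "\<lambda>n f. f e"] exI[where x = "\<lambda>n. 1"] exI[where x = "\<lambda>n j. 1"]
        exI[where x = "\<lambda>n j. e"])
      (auto simp: quadrature_formula_def uniformly_Polya_stable_def intro: exI[where x = 1])
qed

end
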